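(* Let $(S,\mathcal{A}_{blck})$ be a $t$-$(n,k,\lambda)$-design, let $\mu\in[1/2,1)$ with $\mu\ge (t-1)/k$, and let $r$ be the smallest integer strictly greater than $\mu k$ (so $r\ge t$). Let $\gamma\in(0,1)$ with $s=\gamma n\in\mathbb{N}$. Then the efficiency factor $\eta$ of the custody scheme $(S,\mathcal{A}_{blck},\mu)$ against a $\gamma$-adversary (i.e. one corrupting $s=\gamma n$ nodes) satisfies $$\eta \;\ge\; \gamma\cdot\frac{\binom{n}{t}}{\binom{k}{t}}\cdot\frac{\binom{r}{t}}{\binom{s}{t}}-1 ,$$ where the right-hand side is read as $+\infty$ if $\binom{s}{t}=0$.
   Context: A custody scheme $(S,\mathcal{A},\mu)$ consists of a set $S$ of $n$ nodes, a family $\mathcal{A}$ of $m$ $k$-subsets of $S$ (called groups; repetitions are counted with multiplicity), and a threshold $\mu\in[1/2,1)$. For $\gamma\in(0,1)$ with $\gamma n\in\mathbb{N}$ let $$f(\gamma;S,\mathcal{A},\mu):=\max_{B\subseteq S,\ |B|=\gamma n}\big|\{A\in\mathcal{A} : |A\cap B|>\mu k\}\big| .$$ The efficiency factor against a $\gamma$-adversary is $\eta:=\dfrac{\gamma m}{f(\gamma;S,\mathcal{A},\mu)}-1$, with $\eta=+\infty$ if $f=0$. Block design: for positive integers $n,k,\lambda,t$ with $n>k\ge t$, $(S,\mathcal{A}_{blck})$ is a $t$-$(n,k,\lambda)$-design if $|S|=n$ and $\mathcal{A}_{blck}$ is a family of $k$-subsets of $S$ such that every $t$-subset of $S$ is contained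 in exactly $\lambda$ members of $\mathcal{A}_{blck}$. Its number of groups is $m=\lambda\binom{n}{t}/\binom{k}{t}$. *)

theory Defs
  imports Complex_Main "HOL-Library.Multiset" "HOL-Library.Extended_Real"
begin

text \<open>
  A custody scheme is given by its node set \<open>S\<close>, its groups \<open>\<A>\<close>, their common size \<open>k\<close> and the
  threshold \<open>\<mu>\<close>. The groups form a multiset of sets, so repeated groups are counted with
  multiplicity.
\<close>

definition block_design ::
  "'a set \<Rightarrow> 'a set multiset \<Rightarrow> nat \<Rightarrow> nat \<Rightarrow> nat \<Rightarrow> nat \<Rightarrow> bool" where
  "block_design S \<A> t n k l \<longleftrightarrow>
     0 < t \<and> t \<le> k \<and> k < n \<and> 0 < l \<and>
     finite S \<and> card S = n \<and>
     (\<forall>A \<in># \<A>. A \<subseteq> S \<and> card A = k) \<and>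
     (\<forall>T. T \<subseteq> S \<and> card T = t \<longrightarrow> size {#A \<in># \<A>. T \<subseteq> A#} = l)"

definition corrupted_groups ::
  "'a set multiset \<Rightarrow> nat \<Rightarrow> real \<Rightarrow> 'a set \<Rightarrow> 'a set multiset" where
  "corrupted_groups \<A> k \<mu> B = {#A \<in># \<A>. real (card (A \<inter> B)) > \<mu> * real k#}"

text \<open>
  The maximum is over a finite set, which is nonempty whenever \<open>S\<close> is finite, \<open>0 \<le> \<gamma> \<le> 1\<close> and
  \<open>\<gamma> * card S\<close> is a natural number; otherwise the value is unspecified.
\<close>

definition max_corrupted ::
  "real \<Rightarrow> 'a set \<Rightarrow> 'a set multiset \<Rightarrow> nat \<Rightarrow> real \<Rightarrow> nat" where
  "max_corrupted \<gamma> S \<A> k \<mu> =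
     Max {size (corrupted_groups \<A> k \<mu> B) | B. B \<subseteq> S \<and> real (card B) = \<gamma> * real (card S)}"

definition efficiency_factor ::
  "real \<Rightarrow> 'a set \<Rightarrow> 'a set multiset \<Rightarrow> nat \<Rightarrow> real \<Rightarrow> ereal" where
  "efficiency_factor \<gamma> S \<A> k \<mu> =
     (if max_corrupted \<gamma> S \<A> k \<mu> = 0 then \<infinity>
      else ereal (\<gamma> * real (size \<A>) / real (max_corrupted \<gamma> S \<A> k \<mu>) - 1))"

end

theory Submission
  imports Defs
begin

text \<open>
  Count the pairs of a \<open>t\<close>-subset \<open>T\<close> of \<open>B\<close> and a group containing \<open>T\<close> in two ways: there are
  \<open>l * (s choose t)\<close> of them, and every corrupted group, meeting \<open>B\<close> in at least \<open>r\<close> nodes,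
  accounts for at least \<open>r choose t\<close>. For \<open>B = S\<close> the same count gives the number of groups.
\<close>

text \<open>Exchange of summation for an incidence relation. One side runs over a multiset, hence
  the induction on \<open>M\<close>: each added copy of \<open>A\<close> raises both sides by the
  number of \<open>T\<close> incident with it.\<close>

lemma sum_size_filter_mset_swap:
  assumes "finite F"
  shows "(\<Sum>T\<in>F. size {#A \<in># M. P T A#}) = (\<Sum>A\<in>#M. card {T \<in> F. P T A})"
proof (induction M)
  case empty
  then show ?case by simp
next
  case (add A M)
  have "(\<Sum>T\<in>F. size {#A' \<in># add_mset A M. P T A'#})
      = (\<Sum>T\<in>F. (if P T A then 1 else 0) + size {#A' \<in># M. P T A'#})"
    by (intro sum.cong) auto
  also have "\<dots> = card {T \<in> F. P T A} + (\<Sum>T\<in>F. size {#A' \<in># M. P T A'#})"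
    using assms by (simp add: sum.distrib flip: sum.inter_filter)
  finally show ?case using add by simp
qed

lemma block_design_count:
  assumes "block_design S \<A> t n k l" and "B \<subseteq> S"
  shows "(\<Sum>A\<in>#\<A>. card (A \<inter> B) choose t) = l * (card B choose t)"
proof -
  have B: "finite B"
    using assms finite_subset by (auto simp: block_design_def)
  let ?F = "{T. T \<subseteq> B \<and> card T = t}"
  have sub: "card {T \<in> ?F. T \<subseteq> A} = card (A \<inter> B) choose t" for A
  proof -
    have "{T \<in> ?F. T \<subseteq> A} = {T. T \<subseteq> A \<inter> B \<and> card T = t}" by auto
    then show ?thesis using n_subsets[of "A \<inter> B" t] B by (metis finite_Int)
  qed
  have "(\<Sum>A\<in>#\<A>. card (A \<inter> B) choose t) = (\<Sum>T\<in>?F. size {#A \<in># \<A>. T \<subseteq> A#})"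
    unfolding sub[symmetric] by (rule sum_size_filter_mset_swap[symmetric]) (use B in simp)
  \<comment> \<open>Each \<open>T\<close> lies in \<open>B\<close> and hence in \<open>S\<close>, so
    the design property applies to it.\<close>
  also have "\<dots> = (\<Sum>T\<in>?F. l)"
    using assms by (intro sum.cong) (auto simp: block_design_def)
  also have "\<dots> = l * (card B choose t)"
    using B by (simp add: n_subsets)
  finally show ?thesis .
qed

text \<open>Every group meets \<open>S\<close> in all its \<open>k\<close> nodes. The product form
  stays within the naturals; the quotient is taken only in the final estimate.\<close>

lemma block_design_size:
  assumes "block_design S \<A> t n k l"
  shows "size \<A> * (k choose t) = l * (n choose t)"
proof -
  have "(\<Sum>A\<in>#\<A>. card (A \<inter> S) choose t) = (\<Sum>A\<in>#\<A>. k choose t)"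
    using assms
    by (intro arg_cong[of _ _ sum_mset] image_mset_cong) (auto simp: block_design_def Int_absorb2)
  then show ?thesis
    using assms block_design_count[OF assms order_refl] by (simp add: block_design_def)
qed

lemma size_corrupted_groups_le:
  assumes "block_design S \<A> t n k l" and "B \<subseteq> S"
    and r: "\<And>j. \<mu> * real k < real j \<Longrightarrow> r \<le> j"
  shows "size (corrupted_groups \<A> k \<mu> B) * (r choose t) \<le> l * (card B choose t)"
proof -
  have "size (corrupted_groups \<A> k \<mu> B) * (r choose t)
      = (\<Sum>A\<in>#corrupted_groups \<A> k \<mu> B. r choose t)" by simp
  \<comment> \<open>A corrupted group meets \<open>B\<close> in more than \<open>\<mu> * k\<close>
    nodes, hence in at least \<open>r\<close> by the minimality of \<open>r\<close>.\<close>
  also have "\<dots> \<le> (\<Sum>A\<in>#corrupted_groups \<A> k \<mu> B. card (A \<inter> B) choose t)"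
    by (intro sum_mset_mono binomial_right_mono r) (simp add: corrupted_groups_def)
  also have "\<dots> \<le> (\<Sum>A\<in>#\<A>. card (A \<inter> B) choose t)"
  proof -
    have "\<A> = corrupted_groups \<A> k \<mu> B + (\<A> - corrupted_groups \<A> k \<mu> B)"
      by (simp add: corrupted_groups_def)
    then show ?thesis
      by (metis image_mset_union le_add1 sum_mset.union)
  qed
  also have "\<dots> = l * (card B choose t)"
    by (rule block_design_count[OF assms(1,2)])
  finally show ?thesis .
qed

text \<open>\<open>Max\<close> is meaningful only on a finite nonempty set: finiteness comes from
  \<open>Pow S\<close>, nonemptiness from \<open>s \<le> card S\<close>.\<close>

lemma max_corrupted_attained:
  assumes "finite S" and "s \<le> card S" and "real s = \<gamma> * real (card S)"
  obtains B where "B \<subseteq> S" and "card B = s"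
    and "max_corrupted \<gamma> S \<A> k \<mu> = size (corrupted_groups \<A> k \<mu> B)"
proof -
  let ?V = "{size (corrupted_groups \<A> k \<mu> B) | B. B \<subseteq> S \<and> real (card B) = \<gamma> * real (card S)}"
  have "?V \<subseteq> (\<lambda>B. size (corrupted_groups \<A> k \<mu> B)) ` Pow S" by auto
  then have "finite ?V" by (rule finite_subset) (use assms(1) in simp)
  moreover obtain B where "B \<subseteq> S" "card B = s"
    using assms(2) by (rule obtain_subset_with_card_n)
  then have "?V \<noteq> {}" using assms(3) by auto
  ultimately have "Max ?V \<in> ?V" by (rule Max_in)
  then obtain B where "B \<subseteq> S" "real (card B) = \<gamma> * real (card S)"
    and "Max ?V = size (corrupted_groups \<A> k \<mu> B)" by blast
  with assms(3) show thesis
    by (intro that) (simp_all add: max_corrupted_def)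
qed

theorem theorem2:
  fixes S :: "'a set" and \<A> :: "'a set multiset"
    and t n k l r s :: nat and \<mu> \<gamma> :: real
  assumes "block_design S \<A> t n k l"
    and "1 / 2 \<le> \<mu>" and "\<mu> < 1"
    and "(real t - 1) / real k \<le> \<mu>"
    and "\<mu> * real k < real r" and "\<And>j::int. \<mu> * real k < of_int j \<Longrightarrow> int r \<le> j"
    and "0 < \<gamma>" and "\<gamma> < 1"
    and "real s = \<gamma> * real n"
  shows "t \<le> r \<and>
    efficiency_factor \<gamma> S \<A> k \<mu> \<ge>
      (if s choose t = 0 then \<infinity>
       else ereal (\<gamma> * (real (n choose t) / real (k choose t))
                     * (real (r choose t) / real (s choose t)) - 1))"
proof
  have k: "0 < k" "t \<le> k" and S: "finite S" "card S = n"
    using assms(1) by (auto simp: block_design_def)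
  \<comment> \<open>The bound on \<open>\<mu>\<close> gives
    \<open>t - 1 \<le> \<mu> * k < r\<close>, and integrality turns this into
    \<open>t \<le> r\<close>.\<close>
  have "real t - 1 < real r"
    using assms(4,5) k by (simp add: pos_divide_le_eq)
  then show tr: "t \<le> r" by linarith
  let ?f = "max_corrupted \<gamma> S \<A> k \<mu>"
  have "\<gamma> * real n \<le> 1 * real n"
    using assms(8) by (intro mult_right_mono) auto
  then have "s \<le> card S" using assms(9) S by simp
  moreover have "real s = \<gamma> * real (card S)" using assms(9) S by simp
  ultimately obtain B where B: "B \<subseteq> S" "card B = s" "?f = size (corrupted_groups \<A> k \<mu> B)"
    by (rule max_corrupted_attained[OF S(1)])
  have r: "r \<le> j" if "\<mu> * real k < real j" for j
    using assms(6)[of "int j"] that by simp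
  have f: "?f * (r choose t) \<le> l * (s choose t)"
    using size_corrupted_groups_le[OF assms(1) B(1) r] B by simp
  show "efficiency_factor \<gamma> S \<A> k \<mu> \<ge>
      (if s choose t = 0 then \<infinity>
       else ereal (\<gamma> * (real (n choose t) / real (k choose t))
                     * (real (r choose t) / real (s choose t)) - 1))"
  \<comment> \<open>If no group can be corrupted, the efficiency factor is infinite and exceeds any
    bound.\<close>
  proof (cases "?f = 0")
    case True
    then show ?thesis by (simp add: efficiency_factor_def)
  next
    case False
    have r0: "0 < r choose t" using tr by simp
    \<comment> \<open>Otherwise the right side of \<open>f\<close> would vanish while its left side
      is positive; so the infinite bound arises only when \<open>?f = 0\<close>.\<close>
    with f False have s0: "0 < s choose t" by (cases "s choose t") auto
    have k0: "0 < k choose t" using k by simp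
    have f': "real ?f * real (r choose t) \<le> real l * real (s choose t)"
      using f by (metis of_nat_le_iff of_nat_mult)
    have m: "real (size \<A>) = real l * real (n choose t) / real (k choose t)"
      using block_design_size[OF assms(1)] k0
      by (simp add: field_simps flip: of_nat_mult)
    \<comment> \<open>Scaling this by \<open>\<gamma> * (n choose t) / (k choose t)\<close> makes
      \<open>size \<A>\<close> appear on the right, by \<open>m\<close>.\<close>
    have "real (r choose t) / real (s choose t) \<le> real l / real ?f"
      using f' s0 False by (simp add: field_simps)
    then have "\<gamma> * (real (n choose t) / real (k choose t)) * (real (r choose t) / real (s choose t))
        \<le> \<gamma> * (real (n choose t) / real (k choose t)) * (real l / real ?f)"
      using assms(7) by (intro mult_left_mono) auto
    also have "\<dots> = \<gamma> * real (size \<A>) / real ?f"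
      by (simp add: m)
    finally show ?thesis
      using s0 False by (simp add: efficiency_factor_def)
  qed
qed

end
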